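(* Suppose $\alpha_A\le\alpha_B$, $X_A^{o}<\bar X_A<1$, and $\lambda_A\gg\gamma_B>0$ (that is, $\lambda_A$ is sufficiently large). Consider the No-TIC Agreement and assume country $B$ can deviate by setting positive subsidies $s_B>0$ or $e_B>0$ while tariffs remain fixed at $\tau_B=0$. Then country $B$ has strict incentives to choose positive subsidies (i.e. can strictly increase its utility by doing so) if $$\gamma_B>\frac12\,\delta\,\frac{\eta_A}{1+\eta_A}\equiv\gamma_B^{No\text{-}TIC}$$ with $\eta_A=\frac{2-\bar X_A}{\bar X_A}$. Moreover, with $$\gamma_B^{TIC}=\delta\cdot\frac{\eta_A^2+\eta_A-1}{\eta_A^2-1}$$ denoting the threshold above which country $B$ has an incentive to raise its export subsidy under the TIC Agreement, the ratio of the respective thresholds for the TIC Agreement and the No-TIC Agreement is given by $$\frac{\gamma_B^{TIC}}{\gamma_B^{No\text{-}TIC}}=2\,\frac{\eta_A^2+\eta_A-1}{\eta_A(\eta_A-1)}>2.$$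
   Context: There are two countries $A,B$; $i,j\in\{A,B\}$ with $j\ne i$, and every formula for $i$ also holds with $i$ and $j$ swapped. There is a unit mass of products $m\in[0,1]$, each traded on its own independent perfectly competitive market. In each country demand for each product is exactly one unit at every price below a valuation $v$, which is large enough to exceed all equilibrium prices. The technological marginal cost of product $m$ in country $i$ is $w_i(m)$, and $\Delta w_A(m)=w_A(m)-w_B(m)=-\alpha_A+\delta m$, where $\alpha_A,\alpha_B>0$ and $\delta=\alpha_A+\alpha_B$. Instruments of country $i$: production subsidy $s_i\ge 0$, export subsidy $e_i\ge 0$, tariff $\tau_i\ge 0$. Possibly country $i$ has a tradeable import certificate (TIC) scheme with certificate price $\pi_i\ge0$ ($\pi_i=0$ if there is no TIC scheme): each imported unit requires one certificate, each exported unit generates $\eta_i$ certificates, and exporters keep a share $\phi_i\in[0,1]$ of certificate revenues. Effective tariff: $\tilde\tau_i=\tau_i+\pi_i$. Effective export subsidy: $\tilde e_i=e_i+\phi_i\eta_i\pi_i$. Without TIC schemes, $\tilde\tau_i=\tau_i$ and $\tilde e_i=e_i$. Marginal costs: $c_i^{dom}(m)=w_i(m)-s_i$ for domestic sales and $c_i^{exp}(m)=w_i(m)-s_i-\tilde e_i+\tilde\tau_j$ for exports from $i$ to $j$. Market outcome: $q_i^{dom}(m)=1$ if $c_i^{dom}(m)\le c_j^{exp}(m)$ and $0$ otherwise; $q_i^{exp}(m)=1$ if $c_i^{exp}(m)<c_j^{dom}(m)$ and $0$ otherwise. Aggregates: $Q_i^{dom}=\int_0^1q_i^{dom}(m)\,dm$,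 $Q_i^{exp}=\int_0^1q_i^{exp}(m)\,dm$, total production $X_i=Q_i^{dom}+Q_i^{exp}$. $X_A^{o}=2\alpha_A/\delta$ is the free trade level of $X_A$. Direct costs: $d_i^{dom}(m)=w_i(m)$, $d_i^{imp}(m)=w_j(m)-s_j-\tilde e_j$, $d_i^{exp}(m)=\tilde e_i+s_i$, and $$D_i=\int_0^1\left(d_i^{dom}(m)q_i^{dom}(m)+d_i^{imp}(m)q_j^{exp}(m)+d_i^{exp}(m)q_i^{exp}(m)\right)dm.$$ Country $A$ has a production goal $\bar X_A$ and utility $u_A=-\lambda_A\max(\bar X_A-X_A,0)-D_A$; country $B$ has utility $u_B=\gamma_BX_B-D_B$. "$\lambda_A\gg\gamma_B$" is read as: for given values of the other parameters, $\lambda_A$ is sufficiently large. No-TIC Agreement: no TIC schemes; country $A$ fixes $e_A=\tau_A=\alpha_A\bar\chi_A$ with $\bar\chi_A=\frac{\bar X_A-X_A^{o}}{X_A^{o}}$ and $s_A=0$; country $B$ fixes $e_B=\tau_B=s_B=0$. TIC Agreement: country $A$ implements a TIC scheme with $\eta_A=\frac{2-\bar X_A}{\bar X_A}>1$ and $\phi_A\eta_A=1$, country $B$ may implement a TIC scheme with $\eta_B\ge1$, and no country uses direct tariffs or subsidies. *)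

theory Defs
  imports "HOL-Analysis.Analysis"
begin

datatype country = CountryA | CountryB

fun other :: "country \<Rightarrow> country" where
  "other CountryA = CountryB"
| "other CountryB = CountryA"

text \<open>
  A country without a tradeable import certificate scheme is represented by certificate
  price 0; the fields \<open>cert_rate\<close> (certificates generated per exported unit) and
  \<open>cert_share\<close> (share of certificate revenue kept by exporters) are then irrelevant.
\<close>

record instruments =
  prod_subsidy :: real
  exp_subsidy :: real
  tariff :: real
  cert_price :: real
  cert_rate :: real
  cert_share :: real

type_synonym policy = "country \<Rightarrow> instruments"
type_synonym costs = "country \<Rightarrow> real \<Rightarrow> real"

definition eff_tariff :: "instruments \<Rightarrow> real" where
  "eff_tariff p = tariff p + cert_price p"

definition eff_exp_subsidy :: "instruments \<Rightarrow> real" where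
  "eff_exp_subsidy p = exp_subsidy p + cert_share p * cert_rate p * cert_price p"

definition c_dom :: "costs \<Rightarrow> policy \<Rightarrow> country \<Rightarrow> real \<Rightarrow> real" where
  "c_dom w P i m = w i m - prod_subsidy (P i)"

definition c_exp :: "costs \<Rightarrow> policy \<Rightarrow> country \<Rightarrow> real \<Rightarrow> real" where
  "c_exp w P i m =
     w i m - prod_subsidy (P i) - eff_exp_subsidy (P i) + eff_tariff (P (other i))"

text \<open>
  Demand is one unit of each product in each country at every price below the valuation,
  and the valuation exceeds all equilibrium prices, so each market is served in full by
  its cheaper source. Ties are won by the domestic producer.
\<close>

definition q_dom :: "costs \<Rightarrow> policy \<Rightarrow> country \<Rightarrow> real \<Rightarrow> real" where
  "q_dom w P i m = (if c_dom w P i m \<le> c_exp w P (other i) m then 1 else 0)"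

definition q_exp :: "costs \<Rightarrow> policy \<Rightarrow> country \<Rightarrow> real \<Rightarrow> real" where
  "q_exp w P i m = (if c_exp w P i m < c_dom w P (other i) m then 1 else 0)"

definition Q_dom :: "costs \<Rightarrow> policy \<Rightarrow> country \<Rightarrow> real" where
  "Q_dom w P i = (LBINT m:{0..1}. q_dom w P i m)"

definition Q_exp :: "costs \<Rightarrow> policy \<Rightarrow> country \<Rightarrow> real" where
  "Q_exp w P i = (LBINT m:{0..1}. q_exp w P i m)"

definition production :: "costs \<Rightarrow> policy \<Rightarrow> country \<Rightarrow> real" where
  "production w P i = Q_dom w P i + Q_exp w P i"

definition d_dom :: "costs \<Rightarrow> policy \<Rightarrow> country \<Rightarrow> real \<Rightarrow> real" where
  "d_dom w P i m = w i m"

definition d_imp :: "costs \<Rightarrow> policy \<Rightarrow> country \<Rightarrow> real \<Rightarrow> real" where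
  "d_imp w P i m =
     w (other i) m - prod_subsidy (P (other i)) - eff_exp_subsidy (P (other i))"

definition d_exp :: "costs \<Rightarrow> policy \<Rightarrow> country \<Rightarrow> real \<Rightarrow> real" where
  "d_exp w P i m = eff_exp_subsidy (P i) + prod_subsidy (P i)"

definition direct_costs :: "costs \<Rightarrow> policy \<Rightarrow> country \<Rightarrow> real" where
  "direct_costs w P i =
     (LBINT m:{0..1}. d_dom w P i m * q_dom w P i m
                    + d_imp w P i m * q_exp w P (other i) m
                    + d_exp w P i m * q_exp w P i m)"

fun utility :: "real \<Rightarrow> real \<Rightarrow> real \<Rightarrow> costs \<Rightarrow> policy \<Rightarrow> country \<Rightarrow> real" where
  "utility lambda_A Xbar_A gamma_B w P CountryA =
     - lambda_A * max (Xbar_A - production w P CountryA) 0 - direct_costs w P CountryA"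
| "utility lambda_A Xbar_A gamma_B w P CountryB =
     gamma_B * production w P CountryB - direct_costs w P CountryB"

text \<open>The level of \<open>production w P CountryA\<close> when all instruments are zero.\<close>

definition free_trade_X_A :: "real \<Rightarrow> real \<Rightarrow> real" where
  "free_trade_X_A alpha_A alpha_B = 2 * alpha_A / (alpha_A + alpha_B)"

definition chi_A :: "real \<Rightarrow> real \<Rightarrow> real \<Rightarrow> real" where
  "chi_A alpha_A alpha_B Xbar_A =
     (Xbar_A - free_trade_X_A alpha_A alpha_B) / free_trade_X_A alpha_A alpha_B"

definition eta_A :: "real \<Rightarrow> real" where
  "eta_A Xbar_A = (2 - Xbar_A) / Xbar_A"

text \<open>
  The No-TIC Agreement when country B sets the subsidies \<open>s_B\<close> and \<open>e_B\<close>; the agreement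
  itself prescribes \<open>s_B = e_B = 0\<close>.
\<close>

fun no_tic_policy :: "real \<Rightarrow> real \<Rightarrow> real \<Rightarrow> real \<Rightarrow> real \<Rightarrow> policy" where
  "no_tic_policy alpha_A alpha_B Xbar_A s_B e_B CountryA =
     \<lparr>prod_subsidy = 0, exp_subsidy = alpha_A * chi_A alpha_A alpha_B Xbar_A,
      tariff = alpha_A * chi_A alpha_A alpha_B Xbar_A,
      cert_price = 0, cert_rate = 0, cert_share = 0\<rparr>"
| "no_tic_policy alpha_A alpha_B Xbar_A s_B e_B CountryB =
     \<lparr>prod_subsidy = s_B, exp_subsidy = e_B, tariff = 0,
      cert_price = 0, cert_rate = 0, cert_share = 0\<rparr>"

text \<open>
  The TIC Agreement at certificate prices \<open>p\<close> when country B sets the direct export subsidy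
  \<open>e_B\<close>; the agreement itself prescribes \<open>e_B = 0\<close>. Exporters in country A receive the
  share \<open>1 / eta_A\<close> of certificate revenue, that is, the value of one certificate per unit.
\<close>

fun tic_policy :: "real \<Rightarrow> real \<Rightarrow> real \<Rightarrow> (country \<Rightarrow> real) \<Rightarrow> real \<Rightarrow> policy" where
  "tic_policy Xbar_A eta_B phi_B p e_B CountryA =
     \<lparr>prod_subsidy = 0, exp_subsidy = 0, tariff = 0,
      cert_price = p CountryA, cert_rate = eta_A Xbar_A, cert_share = 1 / eta_A Xbar_A\<rparr>"
| "tic_policy Xbar_A eta_B phi_B p e_B CountryB =
     \<lparr>prod_subsidy = 0, exp_subsidy = e_B, tariff = 0,
      cert_price = p CountryB, cert_rate = eta_B, cert_share = phi_B\<rparr>"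

text \<open>
  Imports need one certificate per unit and exports generate \<open>cert_rate\<close> certificates per
  unit; excess supply of certificates is possible only at price 0.
\<close>

definition cert_market_clears :: "costs \<Rightarrow> policy \<Rightarrow> country \<Rightarrow> bool" where
  "cert_market_clears w P i \<longleftrightarrow>
     cert_price (P i) \<ge> 0 \<and>
     Q_exp w P (other i) \<le> cert_rate (P i) * Q_exp w P i \<and>
     (cert_price (P i) > 0 \<longrightarrow> Q_exp w P (other i) = cert_rate (P i) * Q_exp w P i)"

text \<open>
  \<open>T\<close> is the set of countries with a TIC scheme. The last condition discards the degenerate
  outcomes in which both countries have prohibitive certificate prices, nothing is traded,
  and both certificate markets clear at zero volume.
\<close>

definition tic_equilibrium :: "costs \<Rightarrow> country set \<Rightarrow> policy \<Rightarrow> bool" where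
  "tic_equilibrium w T P \<longleftrightarrow>
     (\<forall>i\<in>T. cert_market_clears w P i) \<and>
     (\<forall>i. i \<notin> T \<longrightarrow> cert_price (P i) = 0) \<and>
     (\<exists>i. Q_exp w P i > 0)"

definition gamma_no_tic :: "real \<Rightarrow> real \<Rightarrow> real" where
  "gamma_no_tic \<delta> \<eta> = 1 / 2 * \<delta> * (\<eta> / (1 + \<eta>))"

definition gamma_tic :: "real \<Rightarrow> real \<Rightarrow> real" where
  "gamma_tic \<delta> \<eta> = \<delta> * ((\<eta>\<^sup>2 + \<eta> - 1) / (\<eta>\<^sup>2 - 1))"

end

theory Submission
  imports Defs
begin

text \<open>
  Country A serves country B exactly on the products below a cutoff \<open>u\<close>, country B serves
  country A exactly above a cutoff \<open>v\<close>, so B's production is \<open>2 - u - v\<close> and its costs are a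
  constant plus a quadratic polynomial in \<open>u\<close> plus the subsidy outlay on \<open>1 - v\<close> units.

  Write \<open>x = Xbar_A / 2 = 1 / (1 + \<eta>)\<close>. Both agreements put both cutoffs at \<open>x\<close>.
  Under the No-TIC Agreement a production subsidy \<open>\<delta> t\<close> moves both cutoffs down by \<open>t\<close>, with
  gain \<open>t (2 \<gamma> - \<delta> (1 - x)) - 3/2 \<delta> t\<^sup>2\<close>. Under the TIC Agreement the certificate market
  forces \<open>1 - v = \<eta> u\<close>: an export subsidy moves the cutoffs to \<open>u = x + h\<close> and
  \<open>v = x - \<eta> h\<close>, and the subsidy needed is at least \<open>\<delta> (u - v) = \<delta> (1 + \<eta>) h\<close>. The gain is a
  concave quadratic in \<open>h\<close>, so the sign of its slope at \<open>h = 0\<close> decides.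
\<close>

section \<open>Elementary estimates and integrals over intervals\<close>

text \<open>Near zero a linear term dominates a quadratic one. This turns a positive slope of B's
  gain into a small profitable subsidy; \<open>M\<close> keeps that subsidy in the range where the
  cutoffs are not truncated.\<close>

lemma ex_small_quadratic_pos:
  fixes c d M :: real
  assumes "c > 0" "d > 0" "M > 0"
  obtains t where "0 < t" "t < M" "d * t\<^sup>2 < c * t"
proof
  let ?t = "min (M / 2) (c / (2 * d))"
  show "0 < ?t" "?t < M" using assms by (auto simp: min_def)
  have "d * ?t \<le> d * (c / (2 * d))" using assms by (intro mult_left_mono) auto
  also have "\<dots> < c" using assms by simp
  finally have "d * ?t < c" .
  then have "(d * ?t) * ?t < c * ?t" using \<open>0 < ?t\<close> by (rule mult_strict_right_mono)
  then show "d * ?t\<^sup>2 < c * ?t" by (simp add: power2_eq_square mult.assoc)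
qed

lemma set_integral_affine:
  fixes c d a b :: real
  assumes "a \<le> b"
  shows "set_integrable lborel {a..b} (\<lambda>m. c + d * m)"
    and "(LBINT m:{a..b}. c + d * m) = c * (b - a) + d * (b\<^sup>2 - a\<^sup>2) / 2"
proof -
  show "set_integrable lborel {a..b} (\<lambda>m. c + d * m)"
    by (intro borel_integrable_atLeastAtMost' continuous_intros)
  have "(LBINT m:{a..b}. c + d * m) = (\<integral>m. (c + d * m) * indicator {a..b} m \<partial>lborel)"
    by (simp add: set_lebesgue_integral_def mult.commute)
  also have "\<dots> = (c * b + d * b\<^sup>2 / 2) - (c * a + d * a\<^sup>2 / 2)"
    by (rule integral_FTC_Icc_real[OF assms])
       (auto intro!: derivative_eq_intros continuous_intros)
  finally show "(LBINT m:{a..b}. c + d * m) = c * (b - a) + d * (b\<^sup>2 - a\<^sup>2) / 2"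
    by (simp add: algebra_simps diff_divide_distrib)
qed

text \<open>A single point is a null set. Here \<open>z\<close> will be a cutoff, the only product
  where a strict cost comparison and a closed interval can disagree.\<close>

lemma set_integral_eq_off_point:
  fixes f g :: "real \<Rightarrow> real"
  assumes "\<And>m. m \<noteq> z \<Longrightarrow> indicator A m * f m = indicator B m * g m"
    and "set_integrable lborel B g" "f \<in> borel_measurable borel" "A \<in> sets borel"
  shows "set_integrable lborel A f" "(LBINT m:A. f m) = (LBINT m:B. g m)"
proof -
  have AE: "AE m in lborel. indicator B m *\<^sub>R g m = indicator A m *\<^sub>R f m"
    using AE_lborel_singleton[of z] by eventually_elim (use assms(1) in auto)
  have meas: "(\<lambda>m. indicator A m *\<^sub>R f m) \<in> borel_measurable lborel"
    using assms(3,4) by simp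
  have meas': "(\<lambda>m. indicator B m *\<^sub>R g m) \<in> borel_measurable lborel"
    using assms(2) unfolding set_integrable_def by auto
  show "set_integrable lborel A f"
    using assms(2) meas AE unfolding set_integrable_def by (rule integrable_cong_AE_imp)
  show "(LBINT m:A. f m) = (LBINT m:B. g m)"
    unfolding set_lebesgue_integral_def
    using AE meas meas' by (intro integral_cong_AE) auto
qed

section \<open>Cutoffs for a linear cost gap\<close>

locale linear_cost_gap =
  fixes alpha_A alpha_B \<delta> :: real and w :: costs
  assumes alpha_A_pos: "alpha_A > 0" and alpha_B_pos: "alpha_B > 0"
    and delta: "\<delta> = alpha_A + alpha_B"
    and integrable_w: "set_integrable lborel {0..1} (w i)"
    and cost_gap: "m \<in> {0..1} \<Longrightarrow> w CountryA m - w CountryB m = - alpha_A + \<delta> * m"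
begin

lemma delta_pos: "\<delta> > 0"
  using alpha_A_pos alpha_B_pos delta by simp

text \<open>The product whose cost gap equals \<open>r\<close>, moved to the nearest point of the
  unit interval. Truncation covers the cases where one country serves a market alone.\<close>

definition cutoff :: "real \<Rightarrow> real" where
  "cutoff r = max 0 (min 1 ((alpha_A + r) / \<delta>))"

lemma cutoff_bounds: "0 \<le> cutoff r" "cutoff r \<le> 1"
  by (auto simp: cutoff_def)

lemma cutoff_eq:
  assumes "0 \<le> x" "x \<le> 1" "alpha_A + r = \<delta> * x"
  shows "cutoff r = x"
  using assms delta_pos by (simp add: cutoff_def)

lemma cutoff_mono: "r \<le> r' \<Longrightarrow> cutoff r \<le> cutoff r'"
  unfolding cutoff_def using delta_pos
  by (intro max.mono min.mono order_refl divide_right_mono) auto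

lemma below_cutoff:
  assumes "m \<in> {0..1}" "m \<noteq> cutoff r"
  shows "- alpha_A + \<delta> * m < r \<longleftrightarrow> m \<le> cutoff r"
    and "- alpha_A + \<delta> * m > r \<longleftrightarrow> m \<ge> cutoff r"
proof -
  have *: "- alpha_A + \<delta> * m < r \<longleftrightarrow> m < (alpha_A + r) / \<delta>"
    "- alpha_A + \<delta> * m > r \<longleftrightarrow> m > (alpha_A + r) / \<delta>"
    using delta_pos by (auto simp: field_simps)
  show "- alpha_A + \<delta> * m < r \<longleftrightarrow> m \<le> cutoff r"
    using assms unfolding * cutoff_def by (auto simp: max_def min_def split: if_splits)
  show "- alpha_A + \<delta> * m > r \<longleftrightarrow> m \<ge> cutoff r"
    using assms unfolding * cutoff_def by (auto simp: max_def min_def split: if_splits)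
qed

text \<open>The affine weight is there because the extra cost of B's imports varies linearly over
  the products that A exports.\<close>

lemma set_integral_below:
  fixes c d r :: real
  defines "f \<equiv> \<lambda>m. (c + d * m) * (if - alpha_A + \<delta> * m < r then 1 else 0)"
  shows "set_integrable lborel {0..1} f"
    and "(LBINT m:{0..1}. f m) = c * cutoff r + d * (cutoff r)\<^sup>2 / 2"
proof -
  have eq: "indicator {0..1} m * f m = indicator {0..cutoff r} m * (c + d * m)"
    if "m \<noteq> cutoff r" for m
    using below_cutoff(1)[of m r] cutoff_bounds[of r] that
    by (auto simp: f_def indicator_def)
  have meas: "f \<in> borel_measurable borel" unfolding f_def by measurable
  note int = set_integral_affine[OF cutoff_bounds(1)[of r], of c d]
  note * = set_integral_eq_off_point[OF eq int(1) meas]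
  show "set_integrable lborel {0..1} f" by (rule *) auto
  show "(LBINT m:{0..1}. f m) = c * cutoff r + d * (cutoff r)\<^sup>2 / 2"
    using *(2) int(2) by simp
qed

lemma set_integral_above:
  fixes r :: real
  defines "f \<equiv> \<lambda>m. if r < - alpha_A + \<delta> * m then 1 else (0 :: real)"
  shows "set_integrable lborel {0..1} f"
    and "(LBINT m:{0..1}. f m) = 1 - cutoff r"
proof -
  have eq: "indicator {0..1} m * f m = indicator {cutoff r..1} m * (1 + 0 * m)"
    if "m \<noteq> cutoff r" for m
    using below_cutoff(2)[of m r] cutoff_bounds[of r] that
    by (auto simp: f_def indicator_def)
  have meas: "f \<in> borel_measurable borel" unfolding f_def by measurable
  note int = set_integral_affine[OF cutoff_bounds(2)[of r], of 1 0]
  note * = set_integral_eq_off_point[OF eq int(1) meas]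
  show "set_integrable lborel {0..1} f" by (rule *) auto
  show "(LBINT m:{0..1}. f m) = 1 - cutoff r"
    using *(2) int(2) by simp
qed

section \<open>Trade volumes, production and direct costs of country B in terms of cutoffs\<close>

text \<open>The argument of \<open>cutoff\<close> is the cost gap at which A's exporters break even
  in B's market; A exports below it. For \<open>cutoff_B\<close> it is the gap at which B's
  exporters break even in A's market, and B exports above it.\<close>

definition cutoff_A :: "policy \<Rightarrow> real" where
  "cutoff_A P = cutoff (prod_subsidy (P CountryA) + eff_exp_subsidy (P CountryA)
                        - eff_tariff (P CountryB) - prod_subsidy (P CountryB))"

definition cutoff_B :: "policy \<Rightarrow> real" where
  "cutoff_B P = cutoff (prod_subsidy (P CountryA) + eff_tariff (P CountryA)
                        - eff_exp_subsidy (P CountryB) - prod_subsidy (P CountryB))"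

lemma q_exp_A:
  assumes "m \<in> {0..1}"
  shows "q_exp w P CountryA m =
    (if - alpha_A + \<delta> * m < prod_subsidy (P CountryA) + eff_exp_subsidy (P CountryA)
                        - eff_tariff (P CountryB) - prod_subsidy (P CountryB) then 1 else 0)"
  unfolding q_exp_def c_exp_def c_dom_def using cost_gap[OF assms] by auto

lemma q_exp_B:
  assumes "m \<in> {0..1}"
  shows "q_exp w P CountryB m =
    (if prod_subsidy (P CountryA) + eff_tariff (P CountryA)
                        - eff_exp_subsidy (P CountryB) - prod_subsidy (P CountryB)
        < - alpha_A + \<delta> * m then 1 else 0)"
  unfolding q_exp_def c_exp_def c_dom_def using cost_gap[OF assms] by auto

text \<open>The tie rules, weak at home and strict for exports, are complementary, so no exceptional
  product arises.\<close>

lemma q_dom_B: "q_dom w P CountryB m = 1 - q_exp w P CountryA m"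
  unfolding q_dom_def q_exp_def by auto

lemma Q_exp_A: "Q_exp w P CountryA = cutoff_A P"
proof -
  have "Q_exp w P CountryA = (LBINT m:{0..1}. (1 + 0 * m) * (if - alpha_A + \<delta> * m <
      prod_subsidy (P CountryA) + eff_exp_subsidy (P CountryA)
      - eff_tariff (P CountryB) - prod_subsidy (P CountryB) then 1 else 0))"
    unfolding Q_exp_def by (intro set_lebesgue_integral_cong) (auto simp: q_exp_A)
  then show ?thesis unfolding set_integral_below(2) cutoff_A_def by simp
qed

lemma Q_exp_B: "Q_exp w P CountryB = 1 - cutoff_B P"
  unfolding Q_exp_def cutoff_B_def set_integral_above(2)[symmetric]
  by (intro set_lebesgue_integral_cong) (auto simp: q_exp_B)

lemma set_integrable_q_exp: "set_integrable lborel {0..1} (q_exp w P i)"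
proof (cases i)
  case CountryA
  have "set_integrable lborel {0..1} (\<lambda>m. (1 + 0 * m) * (if - alpha_A + \<delta> * m <
      prod_subsidy (P CountryA) + eff_exp_subsidy (P CountryA)
      - eff_tariff (P CountryB) - prod_subsidy (P CountryB) then 1 else 0))"
    by (rule set_integral_below)
  then show ?thesis unfolding CountryA
    by (subst set_integrable_cong[OF refl refl q_exp_A]) auto
next
  case CountryB
  have "set_integrable lborel {0..1} (\<lambda>m. if prod_subsidy (P CountryA) + eff_tariff (P CountryA)
      - eff_exp_subsidy (P CountryB) - prod_subsidy (P CountryB) < - alpha_A + \<delta> * m then 1 else (0 :: real))"
    by (rule set_integral_above)
  then show ?thesis unfolding CountryB
    by (subst set_integrable_cong[OF refl refl q_exp_B]) auto
qed

lemma production_B: "production w P CountryB = 2 - cutoff_A P - cutoff_B P"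
proof -
  have "set_integrable lborel {0..1} (\<lambda>m::real. 1 :: real)"
    using set_integral_affine(1)[of 0 1 1 0] by simp
  moreover have "(LBINT m:{0..1::real}. 1) = (1 :: real)"
    using set_integral_affine(2)[of 0 1 1 0] by simp
  ultimately have "Q_dom w P CountryB = 1 - Q_exp w P CountryA"
    unfolding Q_dom_def q_dom_B Q_exp_def
    by (subst set_integral_diff) (auto intro: set_integrable_q_exp)
  then show ?thesis
    by (simp add: production_def Q_exp_A Q_exp_B)
qed

text \<open>Supplying everything from home is the baseline. Imports change it by an amount affine in
  the product, so the integral of \<open>w CountryB\<close> is the only unspecified term, and it
  cancels when two policies are compared.\<close>

lemma direct_costs_B:
  "direct_costs w P CountryB = (LBINT m:{0..1}. w CountryB m)
     - (alpha_A + prod_subsidy (P CountryA) + eff_exp_subsidy (P CountryA)) * cutoff_A P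
     + \<delta> * (cutoff_A P)\<^sup>2 / 2
     + (eff_exp_subsidy (P CountryB) + prod_subsidy (P CountryB)) * (1 - cutoff_B P)"
proof -
  define r where "r = prod_subsidy (P CountryA) + eff_exp_subsidy (P CountryA)
      - eff_tariff (P CountryB) - prod_subsidy (P CountryB)"
  define c where "c = - (alpha_A + prod_subsidy (P CountryA) + eff_exp_subsidy (P CountryA))"
  define E where "E = eff_exp_subsidy (P CountryB) + prod_subsidy (P CountryB)"
  \<comment> \<open>\<open>g\<close> is the import cost minus the home production cost, switched on
    only for imported products.\<close>
  define g where "g = (\<lambda>m. (c + \<delta> * m) * (if - alpha_A + \<delta> * m < r then 1 else 0))"
  have g: "set_integrable lborel {0..1} g" "(LBINT m:{0..1}. g m) = c * cutoff r + \<delta> * (cutoff r)\<^sup>2 / 2"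
    unfolding g_def by (rule set_integral_below)+
  have "direct_costs w P CountryB =
      (LBINT m:{0..1}. (w CountryB m + g m) + E * q_exp w P CountryB m)"
    unfolding direct_costs_def
  proof (intro set_lebesgue_integral_cong ballI allI impI)
    fix m :: real assume m: "m \<in> {0..1}"
    have "w CountryA m = w CountryB m + (- alpha_A + \<delta> * m)" using cost_gap[OF m] by simp
    then show "d_dom w P CountryB m * q_dom w P CountryB m
        + d_imp w P CountryB m * q_exp w P (other CountryB) m
        + d_exp w P CountryB m * q_exp w P CountryB m
      = (w CountryB m + g m) + E * q_exp w P CountryB m"
      by (simp add: q_dom_B d_dom_def d_imp_def d_exp_def q_exp_A[OF m] g_def r_def c_def E_def)
  qed auto
  also have "\<dots> = (LBINT m:{0..1}. w CountryB m) + (LBINT m:{0..1}. g m)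
      + E * Q_exp w P CountryB"
    unfolding Q_exp_def
    by (simp add: set_integral_add integrable_w g(1) set_integrable_q_exp)
  finally show ?thesis
    by (simp add: g(2) c_def E_def r_def cutoff_A_def Q_exp_B algebra_simps)
qed

end

section \<open>The production goal and closed forms of the thresholds\<close>

locale production_goal = linear_cost_gap +
  fixes Xbar_A :: real
  assumes free_trade_less: "free_trade_X_A alpha_A alpha_B < Xbar_A" and Xbar_A_less: "Xbar_A < 1"
begin

definition x :: real where "x = Xbar_A / 2"

abbreviation \<eta> :: real where "\<eta> \<equiv> eta_A Xbar_A"

lemma eta_eq: "\<eta> = (1 - x) / x"
  by (simp add: eta_A_def x_def diff_divide_distrib)

text \<open>The free trade level is \<open>2 * alpha_A / \<delta>\<close>, so a goal above it puts
  \<open>x\<close> strictly to the right of the free trade cutoff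
  \<open>alpha_A / \<delta>\<close>.\<close>

lemma x_less: "x < 1 / 2" and alpha_A_less: "alpha_A < \<delta> * x" and x_pos: "x > 0"
proof -
  show "x < 1 / 2" using Xbar_A_less by (simp add: x_def)
  show *: "alpha_A < \<delta> * x"
    using free_trade_less alpha_A_pos alpha_B_pos
    by (simp add: free_trade_X_A_def x_def delta field_simps)
  then have "\<delta> * x > 0" using alpha_A_pos by simp
  then show "x > 0" using delta_pos by (simp add: zero_less_mult_iff)
qed

lemma eta_x: "\<eta> * x = 1 - x"
  using x_pos by (simp add: eta_eq field_simps)

lemma eta_gt_1: "\<eta> > 1"
  using x_pos x_less by (simp add: eta_eq field_simps)

lemma x_eq: "x = 1 / (1 + \<eta>)"
  using eta_x eta_gt_1 by (simp add: field_simps)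

text \<open>This is why A's instruments have their size: without intervention by B they put both
  cutoffs at \<open>x\<close>.\<close>

lemma no_tic_export_subsidy_eq: "alpha_A + alpha_A * chi_A alpha_A alpha_B Xbar_A = \<delta> * x"
proof -
  have "chi_A alpha_A alpha_B Xbar_A = \<delta> * x / alpha_A - 1"
    unfolding chi_A_def free_trade_X_A_def delta[symmetric] x_def
    using alpha_A_pos delta_pos by (simp add: field_simps)
  then show ?thesis using alpha_A_pos by (simp add: right_diff_distrib)
qed

lemma gamma_no_tic_eq: "gamma_no_tic \<delta> \<eta> = \<delta> * (1 - x) / 2"
  using eta_gt_1 by (simp add: gamma_no_tic_def x_eq field_simps)

text \<open>The factor \<open>\<eta> - 1\<close> cancels against \<open>\<eta>\<^sup>2 - 1\<close>.
  In this form the threshold is the zero of B's marginal gain from an export subsidy.\<close>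

lemma gamma_tic_eq: "(\<eta> - 1) * gamma_tic \<delta> \<eta> = \<delta> * (\<eta> - x)"
proof -
  have "(\<eta> - 1) * ((\<eta>\<^sup>2 + \<eta> - 1) / (\<eta>\<^sup>2 - 1)) = (\<eta> - 1) * (((\<eta> + 1) * \<eta> - 1) / ((\<eta> - 1) * (\<eta> + 1)))"
    by (simp add: power2_eq_square algebra_simps)
  also have "(\<eta> - 1) * (((\<eta> + 1) * \<eta> - 1) / ((\<eta> - 1) * (\<eta> + 1))) = ((\<eta> + 1) * \<eta> - 1) / (\<eta> + 1)"
    using eta_gt_1 by simp
  also have "((\<eta> + 1) * \<eta> - 1) / (\<eta> + 1) = \<eta> - 1 / (1 + \<eta>)"
    using eta_gt_1 by (simp add: field_simps)
  finally show ?thesis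
    by (simp only: gamma_tic_def x_eq mult.left_commute)
qed

section \<open>Deviation from the No-TIC Agreement\<close>

lemma no_tic_gain:
  assumes "gamma_B > gamma_no_tic \<delta> \<eta>"
  shows "\<exists>s_B e_B. s_B \<ge> 0 \<and> e_B \<ge> 0 \<and> (s_B > 0 \<or> e_B > 0) \<and>
    utility lambda_A Xbar_A gamma_B w (no_tic_policy alpha_A alpha_B Xbar_A s_B e_B) CountryB
    > utility lambda_A Xbar_A gamma_B w (no_tic_policy alpha_A alpha_B Xbar_A 0 0) CountryB"
proof -
  let ?P = "\<lambda>t. no_tic_policy alpha_A alpha_B Xbar_A (\<delta> * t) 0"
  define C where "C = (LBINT m:{0..1}. w CountryB m)"
  \<comment> \<open>For \<open>t\<close> in this range both cutoffs equal \<open>x - t\<close>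
    without truncation.\<close>
  have U: "utility lambda_A Xbar_A gamma_B w (?P t) CountryB
      = 2 * gamma_B * (1 - (x - t))
        - (C - \<delta> * x * (x - t) + \<delta> * (x - t)\<^sup>2 / 2 + \<delta> * t * (1 - (x - t)))"
    if "0 \<le> t" "t \<le> x" for t
  proof -
    have "cutoff (alpha_A * chi_A alpha_A alpha_B Xbar_A - \<delta> * t) = x - t"
      using that x_less no_tic_export_subsidy_eq by (intro cutoff_eq) (auto simp: algebra_simps)
    then have "cutoff_A (?P t) = x - t" "cutoff_B (?P t) = x - t"
      by (simp_all add: cutoff_A_def cutoff_B_def eff_exp_subsidy_def eff_tariff_def)
    then show ?thesis
      using no_tic_export_subsidy_eq
      by (simp add: production_B direct_costs_B eff_exp_subsidy_def C_def)
  qed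
  \<comment> \<open>Of the coefficient \<open>3 / 2 * \<delta>\<close>, \<open>\<delta>\<close>
    comes from subsidizing the newly won exports and \<open>\<delta> / 2\<close> from making at home
    what was imported more cheaply.\<close>
  obtain t where t: "0 < t" "t < x" "3 / 2 * \<delta> * t\<^sup>2 < (2 * gamma_B - \<delta> * (1 - x)) * t"
    using ex_small_quadratic_pos[of "2 * gamma_B - \<delta> * (1 - x)" "3 / 2 * \<delta>" x]
      assms delta_pos x_pos by (auto simp: gamma_no_tic_eq)
  have "utility lambda_A Xbar_A gamma_B w (?P t) CountryB
      - utility lambda_A Xbar_A gamma_B w (?P 0) CountryB
      = (2 * gamma_B - \<delta> * (1 - x)) * t - 3 / 2 * \<delta> * t\<^sup>2"
    unfolding U[OF less_imp_le[OF t(1)] less_imp_le[OF t(2)]] U[OF order_refl less_imp_le[OF x_pos]]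
    by (simp add: power2_eq_square field_simps)
  then have "utility lambda_A Xbar_A gamma_B w (?P t) CountryB
      > utility lambda_A Xbar_A gamma_B w (?P 0) CountryB"
    using t(3) by simp
  then show ?thesis
    using t(1) delta_pos by (intro exI[of _ "\<delta> * t"] exI[of _ 0]) auto
qed

section \<open>Equilibria and deviations under the TIC Agreement\<close>

text \<open>
  The prices clear A's certificate market only if A's price is positive: at price 0 the cutoffs
  are at most the free trade one, so B's exports exceed \<open>\<eta>\<close> times A's. If B's price were
  positive as well, the two clearing conditions would force zero trade.
\<close>

lemma tic_equilibrium_outcome:
  fixes eta_B phi_B e_B :: real and T :: "country set"
  assumes "CountryA \<in> T" and "eta_B \<ge> 1" and "0 \<le> phi_B" and "e_B \<ge> 0"
    and eq: "tic_equilibrium w T (tic_policy Xbar_A eta_B phi_B p e_B)"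
  shows "p CountryB = 0" "p CountryA = \<delta> * cutoff (p CountryA) - alpha_A"
    "1 - cutoff (p CountryA - e_B) = \<eta> * cutoff (p CountryA)"
proof -
  let ?P = "tic_policy Xbar_A eta_B phi_B p e_B"
  define u where "u = cutoff_A ?P"
  define v where "v = cutoff_B ?P"
  \<comment> \<open>An exporter in A earns \<open>\<eta>\<close> certificates and keeps the share
    \<open>1 / \<eta>\<close>, so A's effective export subsidy equals its effective tariff
    \<open>p CountryA\<close>.\<close>
  have u: "u = cutoff (p CountryA - p CountryB)"
    and v: "v = cutoff (p CountryA - (e_B + phi_B * eta_B * p CountryB))"
    using eta_gt_1 by (simp_all add: u_def v_def cutoff_A_def cutoff_B_def eff_exp_subsidy_def eff_tariff_def)
  have A: "p CountryA \<ge> 0" "1 - v \<le> \<eta> * u" "p CountryA > 0 \<Longrightarrow> 1 - v = \<eta> * u"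
    using eq \<open>CountryA \<in> T\<close>
    by (auto simp: tic_equilibrium_def cert_market_clears_def Q_exp_A Q_exp_B u_def v_def)
  \<comment> \<open>If B has no scheme, its price is zero and the second claim is vacuous.\<close>
  have B: "p CountryB \<ge> 0" "p CountryB > 0 \<Longrightarrow> u = eta_B * (1 - v)"
    using eq
    by (cases "CountryB \<in> T";
        force simp: tic_equilibrium_def cert_market_clears_def Q_exp_A Q_exp_B u_def v_def)+
  have trade: "u > 0 \<or> v < 1"
  proof -
    obtain i where "Q_exp w ?P i > 0" using eq by (auto simp: tic_equilibrium_def)
    then show ?thesis by (cases i) (auto simp: Q_exp_A Q_exp_B u_def v_def)
  qed
  have x1: "cutoff 0 = alpha_A / \<delta>"
    using alpha_A_pos alpha_B_pos delta_pos by (intro cutoff_eq) (auto simp: delta)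
  have pA: "p CountryA > 0"
  proof (rule ccontr)
    assume "\<not> p CountryA > 0"
    then have p0: "p CountryA = 0" using A(1) by simp
    have "phi_B * eta_B * p CountryB \<ge> 0" using B(1) assms by simp
    then have "u \<le> cutoff 0" "v \<le> cutoff 0"
      unfolding u v p0 using B(1) assms(4) by (auto intro!: cutoff_mono)
    then have uv: "u < x" "v < x"
      using alpha_A_less delta_pos unfolding x1 by (auto simp: pos_divide_less_eq mult.commute elim!: le_less_trans)
    have "\<eta> * u < \<eta> * x" using uv(1) eta_gt_1 by simp
    then show False using A(2) uv(2) eta_x by simp
  qed
  show pB: "p CountryB = 0"
  proof (rule ccontr)
    assume "p CountryB \<noteq> 0"
    then have "u = eta_B * (\<eta> * u)" using B A(3)[OF pA] by simp
    moreover have "eta_B * \<eta> > 1"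
      using \<open>eta_B \<ge> 1\<close> eta_gt_1 by (simp add: less_1_mult' less_le_trans mult_le_cancel_right1)
    ultimately have "u = 0" by (simp add: mult.assoc[symmetric])
    then show False using trade A(3)[OF pA] by simp
  qed
  show eq': "1 - cutoff (p CountryA - e_B) = \<eta> * cutoff (p CountryA)"
    using A(3)[OF pA] u v pB by simp
  \<comment> \<open>A cutoff of 1 would require B to export \<open>\<eta> > 1\<close> units. Hence
    A's cutoff is not truncated and determines the price.\<close>
  have "cutoff (p CountryA) < 1"
  proof (rule ccontr)
    assume "\<not> cutoff (p CountryA) < 1"
    then have "cutoff (p CountryA) = 1" using cutoff_bounds(2)[of "p CountryA"] by simp
    then show False using eq' cutoff_bounds(1)[of "p CountryA - e_B"] eta_gt_1 by simp
  qed
  moreover have "(alpha_A + p CountryA) / \<delta> > 0" using pA alpha_A_pos delta_pos by simp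
  ultimately have "cutoff (p CountryA) = (alpha_A + p CountryA) / \<delta>"
    unfolding cutoff_def by linarith
  then show "p CountryA = \<delta> * cutoff (p CountryA) - alpha_A" using delta_pos by simp
qed

text \<open>Describes every equilibrium by the shift \<open>h\<close> of A's export cutoff from
  \<open>x\<close>. The subsidy is only bounded below, since B's cutoff may be truncated at 0, where
  more subsidy changes no trade.\<close>

lemma tic_equilibrium_utility:
  fixes eta_B phi_B e_B :: real and T :: "country set"
  assumes "CountryA \<in> T" and "eta_B \<ge> 1" and "0 \<le> phi_B" and "e_B \<ge> 0"
    and eq: "tic_equilibrium w T (tic_policy Xbar_A eta_B phi_B p e_B)"
  obtains h where "h \<ge> 0" "e_B \<ge> \<delta> * (1 + \<eta>) * h" "e_B = 0 \<Longrightarrow> h = 0"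
    "\<And>lambda_A gamma_B. utility lambda_A Xbar_A gamma_B w (tic_policy Xbar_A eta_B phi_B p e_B) CountryB
      = gamma_B * (2 * (1 - x) + (\<eta> - 1) * h) + \<delta> * (x + h)\<^sup>2 / 2 - e_B * \<eta> * (x + h)
        - (LBINT m:{0..1}. w CountryB m)"
proof -
  define u where "u = cutoff (p CountryA)"
  define v where "v = cutoff (p CountryA - e_B)"
  note outcome = tic_equilibrium_outcome[OF assms]
  have eta_u: "1 - v = \<eta> * u" and pA: "alpha_A + p CountryA = \<delta> * u"
    using outcome by (simp_all add: u_def v_def)
  have "v \<le> u" unfolding u_def v_def using assms(4) by (intro cutoff_mono) simp
  have uv: "u - v = (1 + \<eta>) * (u - x)" using eta_u eta_x by (simp add: algebra_simps)
  \<comment> \<open>With truncation at 1 excluded, truncation can only raise \<open>v\<close> above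
    this quotient, which gives the lower bound on \<open>e_B\<close>.\<close>
  have "(alpha_A + (p CountryA - e_B)) / \<delta> \<le> (\<delta> * u) / \<delta>"
    using pA assms(4) delta_pos by (intro divide_right_mono) auto
  also have "\<dots> \<le> 1" using delta_pos cutoff_bounds(2) by (simp add: u_def)
  finally have "(alpha_A + (p CountryA - e_B)) / \<delta> \<le> v"
    by (simp add: v_def cutoff_def)
  then have e: "e_B \<ge> \<delta> * (u - v)"
    using pA delta_pos by (simp add: field_simps)
  show thesis
  proof (rule that[of "u - x"])
    show "u - x \<ge> 0"
    proof -
      have "(1 + \<eta>) * (u - x) \<ge> 0" using \<open>v \<le> u\<close> uv by simp
      then show ?thesis using eta_gt_1 by (simp add: zero_le_mult_iff)
    qed
    show "e_B \<ge> \<delta> * (1 + \<eta>) * (u - x)"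
      using e unfolding uv by (simp add: mult.assoc)
    show "u - x = 0" if "e_B = 0"
      using that uv eta_gt_1 by (simp add: u_def v_def)
    fix lambda_A gamma_B :: real
    let ?P = "tic_policy Xbar_A eta_B phi_B p e_B"
    have c: "cutoff_A ?P = u" "cutoff_B ?P = v"
      using outcome(1) eta_gt_1
      by (simp_all add: u_def v_def cutoff_A_def cutoff_B_def eff_exp_subsidy_def eff_tariff_def)
    have "production w ?P CountryB = 2 * (1 - x) + (\<eta> - 1) * (u - x)"
      unfolding production_B c using eta_u eta_x by (simp add: algebra_simps)
    moreover have "direct_costs w ?P CountryB
        = (LBINT m:{0..1}. w CountryB m) - \<delta> * u * u + \<delta> * u\<^sup>2 / 2 + e_B * (\<eta> * u)"
      unfolding direct_costs_B c eta_u using outcome(1) eta_gt_1 pA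
      by (simp add: eff_exp_subsidy_def)
    ultimately show "utility lambda_A Xbar_A gamma_B w ?P CountryB
      = gamma_B * (2 * (1 - x) + (\<eta> - 1) * (u - x)) + \<delta> * (x + (u - x))\<^sup>2 / 2
        - e_B * \<eta> * (x + (u - x)) - (LBINT m:{0..1}. w CountryB m)"
      by (simp add: power2_eq_square)
  qed
qed

text \<open>Realizes a prescribed shift with the least possible subsidy: A's price places its cutoff
  at \<open>x + h\<close>, and the subsidy lowers B's to \<open>x - \<eta> * h\<close>, positive by
  the bound on \<open>h\<close>.\<close>

lemma tic_equilibrium_exists:
  fixes eta_B phi_B h :: real and T :: "country set"
  assumes "CountryA \<in> T" and "eta_B \<ge> 1" and "0 \<le> h" and "\<eta> * h < x"
  obtains p where
    "tic_equilibrium w T (tic_policy Xbar_A eta_B phi_B p (\<delta> * (1 + \<eta>) * h))"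
    "\<And>lambda_A gamma_B. utility lambda_A Xbar_A gamma_B w
        (tic_policy Xbar_A eta_B phi_B p (\<delta> * (1 + \<eta>) * h)) CountryB
      = gamma_B * (2 * (1 - x) + (\<eta> - 1) * h) + \<delta> * (x + h)\<^sup>2 / 2
        - \<delta> * (1 + \<eta>) * h * \<eta> * (x + h) - (LBINT m:{0..1}. w CountryB m)"
proof -
  define p where "p = (\<lambda>i. case i of CountryA \<Rightarrow> \<delta> * (x + h) - alpha_A | CountryB \<Rightarrow> 0)"
  have p: "p CountryA = \<delta> * (x + h) - alpha_A" "p CountryB = 0" by (simp_all add: p_def)
  define e where "e = \<delta> * (1 + \<eta>) * h"
  let ?P = "tic_policy Xbar_A eta_B phi_B p e"
  have "h \<le> \<eta> * h" using eta_gt_1 \<open>0 \<le> h\<close> by (simp add: mult_le_cancel_right1)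
  then have h: "x + h < 1" "x - \<eta> * h > 0" "x - \<eta> * h \<le> 1" using \<open>0 \<le> h\<close> \<open>\<eta> * h < x\<close> x_less by auto
  have "cutoff (p CountryA) = x + h"
    using h x_pos \<open>0 \<le> h\<close> by (intro cutoff_eq) (auto simp: p)
  moreover have "cutoff (p CountryA - e) = x - \<eta> * h"
    using h x_less \<open>0 \<le> h\<close> eta_gt_1
    by (intro cutoff_eq) (auto simp: p e_def algebra_simps)
  ultimately have c: "cutoff_A ?P = x + h" "cutoff_B ?P = x - \<eta> * h"
    using eta_gt_1
    by (simp_all add: cutoff_A_def cutoff_B_def eff_exp_subsidy_def eff_tariff_def p)
  have clear: "1 - (x - \<eta> * h) = \<eta> * (x + h)" using eta_x by (simp add: algebra_simps)
  have "\<delta> * x \<le> \<delta> * (x + h)" using delta_pos \<open>0 \<le> h\<close> by simp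
  then have "cert_market_clears w ?P CountryA"
    using alpha_A_less clear
    by (simp add: cert_market_clears_def Q_exp_A Q_exp_B c p)
  \<comment> \<open>At price 0 excess supply is allowed, and B exports \<open>\<eta>\<close> times
    as much as A.\<close>
  moreover have "cert_market_clears w ?P CountryB"
  proof -
    have "1 * 1 \<le> eta_B * \<eta>"
      using \<open>eta_B \<ge> 1\<close> eta_gt_1 by (intro mult_mono) auto
    then have "1 * (x + h) \<le> (eta_B * \<eta>) * (x + h)"
      using x_pos \<open>0 \<le> h\<close> by (intro mult_right_mono) auto
    then show ?thesis
      by (simp add: cert_market_clears_def Q_exp_A Q_exp_B c p clear mult.assoc)
  qed
  ultimately have "cert_market_clears w ?P i" for i by (cases i) auto
  moreover have "cert_price (?P CountryB) = 0" by (simp add: p)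
  moreover have "Q_exp w ?P CountryA > 0" using x_pos \<open>0 \<le> h\<close> by (simp add: Q_exp_A c)
  ultimately have eq: "tic_equilibrium w T ?P"
    using \<open>CountryA \<in> T\<close> unfolding tic_equilibrium_def by (metis country.exhaust)
  have "utility lambda_A Xbar_A gamma_B w ?P CountryB
      = gamma_B * (2 * (1 - x) + (\<eta> - 1) * h) + \<delta> * (x + h)\<^sup>2 / 2
        - e * \<eta> * (x + h) - (LBINT m:{0..1}. w CountryB m)" for lambda_A gamma_B
    unfolding utility.simps production_B direct_costs_B c clear using eta_gt_1
    by (simp add: eff_exp_subsidy_def p power2_eq_square algebra_simps)
  then show thesis using that[of p] eq by (simp add: e_def)
qed

text \<open>Both directions compare with the gain \<open>S * h - K * h\<^sup>2\<close> at the least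
  subsidy supporting \<open>h\<close>: \<open>S > 0\<close> makes it positive for small
  \<open>h\<close>, and \<open>S \<le> 0\<close> for no \<open>h \<ge> 0\<close>.\<close>

lemma tic_gain_iff:
  fixes eta_B phi_B gamma_B lambda_A :: real and T :: "country set"
  assumes "CountryA \<in> T" and "eta_B \<ge> 1" and "0 \<le> phi_B"
  shows "gamma_B > gamma_tic \<delta> \<eta> \<longleftrightarrow>
    (\<exists>p p' e_B. e_B > 0 \<and>
      tic_equilibrium w T (tic_policy Xbar_A eta_B phi_B p 0) \<and>
      tic_equilibrium w T (tic_policy Xbar_A eta_B phi_B p' e_B) \<and>
      utility lambda_A Xbar_A gamma_B w (tic_policy Xbar_A eta_B phi_B p' e_B) CountryB
      > utility lambda_A Xbar_A gamma_B w (tic_policy Xbar_A eta_B phi_B p 0) CountryB)"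
    (is "_ \<longleftrightarrow> ?gain")
proof -
  define S where "S = (\<eta> - 1) * gamma_B - \<delta> * (\<eta> - x)"
  define K where "K = \<delta> * (\<eta> * (1 + \<eta>) - 1 / 2)"
  define V where "V = (\<lambda>h e. gamma_B * (2 * (1 - x) + (\<eta> - 1) * h) + \<delta> * (x + h)\<^sup>2 / 2
        - e * \<eta> * (x + h) - (LBINT m:{0..1}. w CountryB m))"
  have S: "S > 0 \<longleftrightarrow> gamma_B > gamma_tic \<delta> \<eta>"
  proof -
    have "S = (\<eta> - 1) * (gamma_B - gamma_tic \<delta> \<eta>)"
      using gamma_tic_eq by (simp add: S_def algebra_simps)
    then show ?thesis using eta_gt_1 by (simp add: zero_less_mult_iff)
  qed
  have "1 * 1 < \<eta> * (1 + \<eta>)" using eta_gt_1 by (intro mult_strict_mono) auto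
  then have K: "K > 0" using delta_pos by (simp add: K_def)
  have V: "V h (\<delta> * (1 + \<eta>) * h) - V 0 0 = S * h - K * h\<^sup>2" for h
  proof -
    \<comment> \<open>Since \<open>(1 + \<eta>) * x = 1\<close>, the outlay term linear in
      \<open>h\<close> is \<open>\<delta> * \<eta> * h\<close>.\<close>
    have "(1 + \<eta>) * \<eta> * x = \<eta>"
      unfolding x_eq using eta_gt_1 by simp
    then have "\<delta> * h * ((1 + \<eta>) * \<eta> * x) = \<delta> * h * \<eta>" by simp
    then show ?thesis
      by (simp add: V_def S_def K_def power2_eq_square field_simps)
  qed
  show ?thesis
  proof
    assume "gamma_B > gamma_tic \<delta> \<eta>"
    then obtain h where h: "0 < h" "h < x / \<eta>" "K * h\<^sup>2 < S * h"
      using ex_small_quadratic_pos[of S K "x / \<eta>"] S K x_pos eta_gt_1 by auto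
    have "\<eta> * h < x" using h(2) eta_gt_1 by (simp add: field_simps)
    then obtain p' where p': "tic_equilibrium w T (tic_policy Xbar_A eta_B phi_B p' (\<delta> * (1 + \<eta>) * h))"
      "utility lambda_A Xbar_A gamma_B w
        (tic_policy Xbar_A eta_B phi_B p' (\<delta> * (1 + \<eta>) * h)) CountryB = V h (\<delta> * (1 + \<eta>) * h)"
      using tic_equilibrium_exists[OF assms(1,2), of h phi_B] h(1) unfolding V_def
      by (metis less_imp_le)
    obtain p where p: "tic_equilibrium w T (tic_policy Xbar_A eta_B phi_B p 0)"
      "utility lambda_A Xbar_A gamma_B w (tic_policy Xbar_A eta_B phi_B p 0) CountryB = V 0 0"
      using tic_equilibrium_exists[OF assms(1,2), of 0 phi_B] x_pos unfolding V_def by auto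
    show ?gain
      using p p' V[of h] h(1,3) delta_pos eta_gt_1
      by (intro exI[of _ p] exI[of _ p'] exI[of _ "\<delta> * (1 + \<eta>) * h"]) auto
  next
    assume ?gain
    then obtain p p' e where e: "e > 0"
      and p: "tic_equilibrium w T (tic_policy Xbar_A eta_B phi_B p 0)"
      and p': "tic_equilibrium w T (tic_policy Xbar_A eta_B phi_B p' e)"
      and less: "utility lambda_A Xbar_A gamma_B w (tic_policy Xbar_A eta_B phi_B p 0) CountryB
        < utility lambda_A Xbar_A gamma_B w (tic_policy Xbar_A eta_B phi_B p' e) CountryB"
      by blast
    \<comment> \<open>All equilibria without a subsidy give B the same utility, so the choice of
      \<open>p\<close> cannot create a spurious gain.\<close>
    obtain h0 where "h0 = 0"
      "utility lambda_A Xbar_A gamma_B w (tic_policy Xbar_A eta_B phi_B p 0) CountryB = V h0 0"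
      using tic_equilibrium_utility[OF assms(1-3) order_refl p] unfolding V_def by metis
    moreover obtain h where h: "h \<ge> 0" "e \<ge> \<delta> * (1 + \<eta>) * h"
      "utility lambda_A Xbar_A gamma_B w (tic_policy Xbar_A eta_B phi_B p' e) CountryB = V h e"
      using tic_equilibrium_utility[OF assms(1-3) less_imp_le[OF e] p'] unfolding V_def by metis
    ultimately have "V h e > V 0 0" using less by simp
    \<comment> \<open>Cutting the subsidy to the least one compatible with \<open>h\<close> only
      saves outlay.\<close>
    moreover have "V h e \<le> V h (\<delta> * (1 + \<eta>) * h)"
    proof -
      have "(\<delta> * (1 + \<eta>) * h) * (\<eta> * (x + h)) \<le> e * (\<eta> * (x + h))"
        using h x_pos eta_gt_1 by (intro mult_right_mono) auto
      then show ?thesis by (simp add: V_def mult.assoc)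
    qed
    ultimately have "S * h > K * h\<^sup>2" using V[of h] by simp
    moreover have "K * h\<^sup>2 \<ge> 0" using K by simp
    ultimately have "S * h > 0" by simp
    then show "gamma_B > gamma_tic \<delta> \<eta>" using h(1) S by (simp add: zero_less_mult_iff)
  qed
qed

end

section \<open>Comparison of the two thresholds and conclusion\<close>

text \<open>A factor \<open>1 + \<eta>\<close> cancels. The bound holds because
  \<open>\<eta>\<^sup>2 + \<eta> - 1\<close> exceeds \<open>\<eta> * (\<eta> - 1)\<close> by
  \<open>2 * \<eta> - 1 > 0\<close>.\<close>

lemma threshold_ratio:
  fixes \<delta> \<eta> :: real
  assumes "\<delta> > 0" "\<eta> > 1"
  shows "gamma_tic \<delta> \<eta> / gamma_no_tic \<delta> \<eta> = 2 * ((\<eta>\<^sup>2 + \<eta> - 1) / (\<eta> * (\<eta> - 1)))"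
    and "gamma_tic \<delta> \<eta> / gamma_no_tic \<delta> \<eta> > 2"
proof -
  have "\<eta>\<^sup>2 - 1 = (\<eta> - 1) * (1 + \<eta>)" by (simp add: power2_eq_square algebra_simps)
  moreover have "\<eta> \<noteq> 0" "\<eta> - 1 \<noteq> 0" "1 + \<eta> \<noteq> 0" "\<delta> \<noteq> 0" using assms by auto
  ultimately show *: "gamma_tic \<delta> \<eta> / gamma_no_tic \<delta> \<eta> = 2 * ((\<eta>\<^sup>2 + \<eta> - 1) / (\<eta> * (\<eta> - 1)))"
    unfolding gamma_tic_def gamma_no_tic_def by (simp add: divide_simps) (simp add: algebra_simps)
  have "\<eta> * (\<eta> - 1) < \<eta>\<^sup>2 + \<eta> - 1" using assms by (simp add: power2_eq_square algebra_simps)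
  then have "1 < (\<eta>\<^sup>2 + \<eta> - 1) / (\<eta> * (\<eta> - 1))" using assms by (subst less_divide_eq_1_pos) auto
  then show "gamma_tic \<delta> \<eta> / gamma_no_tic \<delta> \<eta> > 2"
    unfolding * by linarith
qed

theorem proposition7:
  fixes alpha_A alpha_B \<delta> Xbar_A gamma_B eta_B phi_B :: real
    and w :: costs and T :: "country set"
  assumes "alpha_A > 0" and "alpha_B > 0" and "\<delta> = alpha_A + alpha_B"
    and "\<forall>i. set_integrable lborel {0..1} (w i)"
    and "\<forall>m\<in>{0..1}. w CountryA m - w CountryB m = - alpha_A + \<delta> * m"
    and "alpha_A \<le> alpha_B"
    and "free_trade_X_A alpha_A alpha_B < Xbar_A" and "Xbar_A < 1"
    and "gamma_B > 0"
    and "CountryA \<in> T" and "eta_B \<ge> 1" and "0 \<le> phi_B" and "phi_B \<le> 1"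
  shows "(\<forall>\<^sub>F lambda_A in at_top.
           (gamma_B > gamma_no_tic \<delta> (eta_A Xbar_A) \<longrightarrow>
             (\<exists>s_B e_B. s_B \<ge> 0 \<and> e_B \<ge> 0 \<and> (s_B > 0 \<or> e_B > 0) \<and>
                utility lambda_A Xbar_A gamma_B w
                  (no_tic_policy alpha_A alpha_B Xbar_A s_B e_B) CountryB
                > utility lambda_A Xbar_A gamma_B w
                  (no_tic_policy alpha_A alpha_B Xbar_A 0 0) CountryB))
         \<and> (gamma_B > gamma_tic \<delta> (eta_A Xbar_A) \<longleftrightarrow>
             (\<exists>p p' e_B. e_B > 0 \<and>
                tic_equilibrium w T (tic_policy Xbar_A eta_B phi_B p 0) \<and>
                tic_equilibrium w T (tic_policy Xbar_A eta_B phi_B p' e_B) \<and>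
                utility lambda_A Xbar_A gamma_B w
                  (tic_policy Xbar_A eta_B phi_B p' e_B) CountryB
                > utility lambda_A Xbar_A gamma_B w
                  (tic_policy Xbar_A eta_B phi_B p 0) CountryB)))
       \<and> gamma_tic \<delta> (eta_A Xbar_A) / gamma_no_tic \<delta> (eta_A Xbar_A)
           = 2 * (((eta_A Xbar_A)\<^sup>2 + eta_A Xbar_A - 1) / (eta_A Xbar_A * (eta_A Xbar_A - 1)))
       \<and> gamma_tic \<delta> (eta_A Xbar_A) / gamma_no_tic \<delta> (eta_A Xbar_A) > 2"
proof -
  interpret production_goal alpha_A alpha_B \<delta> w Xbar_A
    using assms by unfold_locales auto
  show ?thesis
    using no_tic_gain tic_gain_iff[OF assms(10-12)]
      threshold_ratio[OF delta_pos eta_gt_1] by (intro conjI always_eventually allI impI)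
qed

end
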